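(* Let $n\ge 3$, $d\ge 1$, let $\delta=\sum_{i=1}^n\varepsilon_i\,dx_i\otimes dx_i$ with $\varepsilon_i=\pm1$ on $\mathbb R^n$, let $(F^d,g_F)$ be a semi-Riemannian manifold with constant scalar curvature $\lambda_F$, let $\alpha\in\mathbb R^n$ be nonzero, $\xi(x)=\sum_i\alpha_ix_i$ and $\|\alpha\|^2=\sum_i\varepsilon_i\alpha_i^2$. Let $\varphi,f,h:(a,b)\to(0,\infty)$ be smooth and suppose that $$g=\frac{\delta}{\varphi(\xi(x))^2}+f(\xi(x))^2g_F\quad\text{on }\xi^{-1}((a,b))\times F^d$$ is a gradient Yamabe soliton with potential function $h\circ\xi$. If $\|\alpha\|^2=0$ and $\lambda_F\ne0$, then the warped product is a standard semi-Riemannian product, i.e. $f$ is constant.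
   Context: A semi-Riemannian manifold $(M,g)$ is a gradient Yamabe soliton with potential function $u\in C^\infty(M)$ and soliton constant $\rho\in\mathbb R$ if $(S_g-\rho)g=\mathrm{Hess}_g(u)$, where $S_g$ is the scalar curvature of $g$. The function $h\circ\xi$ is regarded as a function on $\xi^{-1}((a,b))\times F$ via the projection to the first factor. *)

theory Defs
  imports "HOL-Analysis.Analysis"
begin

section \<open>Smooth maps between Euclidean spaces\<close>

text \<open>These notions are meant for open sets: the derivative at a point of the set is taken in the
  ambient space.\<close>

primrec C_k_on :: "nat \<Rightarrow> ('a::euclidean_space \<Rightarrow> 'b::real_normed_vector) \<Rightarrow> 'a set \<Rightarrow> bool" where
  "C_k_on 0 f S \<longleftrightarrow> continuous_on S f"
| "C_k_on (Suc k) f S \<longleftrightarrow> (\<forall>x\<in>S. f differentiable (at x)) \<and>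
     (\<forall>v. C_k_on k (\<lambda>x. frechet_derivative f (at x) v) S)"

definition smooth_on :: "'a::euclidean_space set \<Rightarrow> ('a \<Rightarrow> 'b::real_normed_vector) \<Rightarrow> bool" where
  "smooth_on S f \<longleftrightarrow> (\<forall>k. C_k_on k f S)"

section \<open>Smooth manifolds\<close>

text \<open>A manifold with a smooth atlas, presented as a family of charts indexed by \<open>charts\<close>. The values
  of a chart map outside of its domain are irrelevant.\<close>

record ('p, 'i, 'e) manifold =
  mtop :: "'p topology"
  charts :: "'i set"
  cdom :: "'i \<Rightarrow> 'p set"
  cmap :: "'i \<Rightarrow> 'p \<Rightarrow> 'e"

definition cimg :: "('p, 'i, 'e) manifold \<Rightarrow> 'i \<Rightarrow> 'e set" where
  "cimg M i = cmap M i ` cdom M i"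

definition cinv :: "('p, 'i, 'e) manifold \<Rightarrow> 'i \<Rightarrow> 'e \<Rightarrow> 'p" where
  "cinv M i = inv_into (cdom M i) (cmap M i)"

definition transition :: "('p, 'i, 'e) manifold \<Rightarrow> 'i \<Rightarrow> 'i \<Rightarrow> 'e \<Rightarrow> 'e" where
  "transition M i j = cmap M j \<circ> cinv M i"

definition overlap :: "('p, 'i, 'e) manifold \<Rightarrow> 'i \<Rightarrow> 'i \<Rightarrow> 'e set" where
  "overlap M i j = cmap M i ` (cdom M i \<inter> cdom M j)"

definition smooth_manifold :: "('p, 'i, 'e::euclidean_space) manifold \<Rightarrow> bool" where
  "smooth_manifold M \<longleftrightarrow>
     topspace (mtop M) \<noteq> {} \<and> Hausdorff_space (mtop M) \<and> second_countable (mtop M) \<and>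
     (\<Union>i\<in>charts M. cdom M i) = topspace (mtop M) \<and>
     (\<forall>i\<in>charts M. openin (mtop M) (cdom M i) \<and> open (cimg M i) \<and>
        homeomorphic_map (subtopology (mtop M) (cdom M i)) (top_of_set (cimg M i)) (cmap M i)) \<and>
     (\<forall>i\<in>charts M. \<forall>j\<in>charts M. smooth_on (overlap M i j) (transition M i j))"

definition smooth_fun :: "('p, 'i, 'e::euclidean_space) manifold \<Rightarrow> ('p \<Rightarrow> real) \<Rightarrow> bool" where
  "smooth_fun M u \<longleftrightarrow> (\<forall>i\<in>charts M. smooth_on (cimg M i) (u \<circ> cinv M i))"

text \<open>An open subset of a Euclidean space, with the identity as its only chart.\<close>

definition open_manifold :: "'e::euclidean_space set \<Rightarrow> ('e, unit, 'e) manifold" where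
  "open_manifold W = \<lparr>mtop = top_of_set W, charts = {()}, cdom = (\<lambda>_. W), cmap = (\<lambda>_ x. x)\<rparr>"

definition product_manifold ::
  "('p, 'i, 'e) manifold \<Rightarrow> ('q, 'j, 'f) manifold \<Rightarrow> ('p \<times> 'q, 'i \<times> 'j, 'e \<times> 'f) manifold" where
  "product_manifold M N =
     \<lparr>mtop = prod_topology (mtop M) (mtop N),
      charts = charts M \<times> charts N,
      cdom = (\<lambda>(i, j). cdom M i \<times> cdom N j),
      cmap = (\<lambda>(i, j). map_prod (cmap M i) (cmap N j))\<rparr>"

section \<open>Semi-Riemannian metrics\<close>

text \<open>A covariant 2-tensor field is given by its representations in the charts: \<open>g i x v w\<close> is the
  value, at the point with coordinates \<open>x\<close> in the chart \<open>i\<close>, on the tangent vectors with components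
  \<open>v\<close> and \<open>w\<close>. It is relevant only for \<open>x\<close> in the image of the chart.\<close>

type_synonym 'e form_field = "'e \<Rightarrow> 'e \<Rightarrow> 'e \<Rightarrow> real"
type_synonym ('i, 'e) tensor2 = "'i \<Rightarrow> 'e form_field"

definition smooth_tensor2 :: "('p, 'i, 'e::euclidean_space) manifold \<Rightarrow> ('i, 'e) tensor2 \<Rightarrow> bool" where
  "smooth_tensor2 M g \<longleftrightarrow>
     (\<forall>i\<in>charts M. (\<forall>x\<in>cimg M i. bilinear (g i x)) \<and> (\<forall>v w. smooth_on (cimg M i) (\<lambda>x. g i x v w))) \<and>
     (\<forall>i\<in>charts M. \<forall>j\<in>charts M. \<forall>x\<in>overlap M i j. \<forall>v w.
        g i x v w = g j (transition M i j x)
          (frechet_derivative (transition M i j) (at x) v)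
          (frechet_derivative (transition M i j) (at x) w))"

definition form_index :: "('e::euclidean_space \<Rightarrow> 'e \<Rightarrow> real) \<Rightarrow> nat" where
  "form_index b = Max {dim W | W. subspace W \<and> (\<forall>w\<in>W. w \<noteq> 0 \<longrightarrow> b w w < 0)}"

definition semi_riemannian_manifold ::
  "('p, 'i, 'e::euclidean_space) manifold \<Rightarrow> ('i, 'e) tensor2 \<Rightarrow> bool" where
  "semi_riemannian_manifold M g \<longleftrightarrow>
     smooth_manifold M \<and> smooth_tensor2 M g \<and>
     (\<forall>i\<in>charts M. \<forall>x\<in>cimg M i.
        (\<forall>v w. g i x v w = g i x w v) \<and> (\<forall>v. (\<forall>w. g i x v w = 0) \<longrightarrow> v = 0)) \<and>
     (\<exists>\<nu>. \<forall>i\<in>charts M. \<forall>x\<in>cimg M i. form_index (g i x) = \<nu>)"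

text \<open>The metric \<open>g\<^sub>B + f\<^sup>2 g\<^sub>F\<close> on \<open>B \<times> F\<close>.\<close>

definition warped_metric ::
  "('p, 'i, 'e) manifold \<Rightarrow> ('i, 'e) tensor2 \<Rightarrow> ('p \<Rightarrow> real) \<Rightarrow> ('j, 'f) tensor2 \<Rightarrow>
     ('i \<times> 'j, 'e \<times> 'f) tensor2" where
  "warped_metric B gB f gF = (\<lambda>(i, j) (x, y) (v, v') (w, w').
     gB i x v w + (f (cinv B i x))\<^sup>2 * gF j y v' w')"

section \<open>Curvature and Hessian in coordinates\<close>

text \<open>Coordinates are taken with respect to \<open>Basis\<close>, whose elements serve as coordinate indices.\<close>

definition pd :: "'e::euclidean_space \<Rightarrow> ('e \<Rightarrow> real) \<Rightarrow> 'e \<Rightarrow> real" where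
  "pd a f x = frechet_derivative f (at x) a"

text \<open>The entries \<open>g\<^sup>a\<^sup>b\<close> of the inverse of the matrix with entries \<open>g x a b\<close>.\<close>

definition inv_metric :: "'e::euclidean_space form_field \<Rightarrow> 'e form_field" where
  "inv_metric g x a b = inv (\<lambda>v. \<Sum>c\<in>Basis. g x c v *\<^sub>R c) b \<bullet> a"

text \<open>\<open>christoffel g k i j\<close> is \<open>\<Gamma>\<close> with upper index \<open>k\<close> and lower indices \<open>i\<close>, \<open>j\<close>.\<close>

definition christoffel :: "'e::euclidean_space form_field \<Rightarrow> 'e \<Rightarrow> 'e \<Rightarrow> 'e \<Rightarrow> 'e \<Rightarrow> real" where
  "christoffel g k i j x =
     (\<Sum>l\<in>Basis. inv_metric g x k l *
        (pd i (\<lambda>y. g y j l) x + pd j (\<lambda>y. g y i l) x - pd l (\<lambda>y. g y i j) x)) / 2"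

text \<open>\<open>riemann g l i j k\<close> is the component along \<open>l\<close> of
  \<open>R(i, j) k = \<nabla>\<^sub>i \<nabla>\<^sub>j k - \<nabla>\<^sub>j \<nabla>\<^sub>i k\<close>, for coordinate vector fields \<open>i\<close>, \<open>j\<close>, \<open>k\<close>. With the
  contraction below, round spheres have positive scalar curvature.\<close>

definition riemann :: "'e::euclidean_space form_field \<Rightarrow> 'e \<Rightarrow> 'e \<Rightarrow> 'e \<Rightarrow> 'e \<Rightarrow> 'e \<Rightarrow> real" where
  "riemann g l i j k x =
     pd i (christoffel g l j k) x - pd j (christoffel g l i k) x +
     (\<Sum>m\<in>Basis. christoffel g l i m x * christoffel g m j k x
               - christoffel g l j m x * christoffel g m i k x)"

definition ricci :: "'e::euclidean_space form_field \<Rightarrow> 'e \<Rightarrow> 'e \<Rightarrow> 'e \<Rightarrow> real" where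
  "ricci g j k x = (\<Sum>i\<in>Basis. riemann g i i j k x)"

definition scalar_curvature :: "'e::euclidean_space form_field \<Rightarrow> 'e \<Rightarrow> real" where
  "scalar_curvature g x = (\<Sum>j\<in>Basis. \<Sum>k\<in>Basis. inv_metric g x j k * ricci g j k x)"

definition hessian :: "'e::euclidean_space form_field \<Rightarrow> ('e \<Rightarrow> real) \<Rightarrow> 'e \<Rightarrow> 'e \<Rightarrow> 'e \<Rightarrow> real" where
  "hessian g u i j x = pd i (pd j u) x - (\<Sum>k\<in>Basis. christoffel g k i j x * pd k u x)"

text \<open>The following are equations between tensor fields, required in every chart.\<close>

definition constant_scalar_curvature ::
  "('p, 'i, 'e::euclidean_space) manifold \<Rightarrow> ('i, 'e) tensor2 \<Rightarrow> real \<Rightarrow> bool" where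
  "constant_scalar_curvature M g \<kappa> \<longleftrightarrow>
     (\<forall>i\<in>charts M. \<forall>x\<in>cimg M i. scalar_curvature (g i) x = \<kappa>)"

definition gradient_yamabe_soliton ::
  "('p, 'i, 'e::euclidean_space) manifold \<Rightarrow> ('i, 'e) tensor2 \<Rightarrow> ('p \<Rightarrow> real) \<Rightarrow> real \<Rightarrow> bool" where
  "gradient_yamabe_soliton M g u \<rho> \<longleftrightarrow>
     semi_riemannian_manifold M g \<and> smooth_fun M u \<and>
     (\<forall>i\<in>charts M. \<forall>x\<in>cimg M i. \<forall>a\<in>Basis. \<forall>b\<in>Basis.
        (scalar_curvature (g i) x - \<rho>) * g i x a b = hessian (g i) (u \<circ> cinv M i) a b x)"

end

theory Submission
  imports Defs
begin

text \<open>
  Along a null direction \<open>\<alpha>\<close> the base contributes nothing to the scalar curvature. The general formula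
  for \<open>\<delta>/\<phi>\<^sup>2 + f\<^sup>2 g\<^sub>F\<close> consists of \<open>\<lambda>\<^sub>F/f\<^sup>2\<close>, of the scalar curvature of the base, and of terms in
  the Laplacian and in the squared gradient of \<open>f\<close>; as all functions depend on \<open>\<xi>\<close> alone, each term but the
  first is a multiple of \<open>\<parallel>\<alpha>\<parallel>\<^sup>2 = 0\<close>. Hence the scalar curvature is \<open>\<lambda>\<^sub>F/f\<^sup>2\<close>
  (\<open>scalar_curvature_null_warped\<close>).

  On the other hand, the Hessian of \<open>h \<circ> \<xi>\<close> restricted to the base is \<open>(h'' + 2 (\<phi>'/\<phi>) h') \<alpha> \<otimes> \<alpha>\<close>
  (\<open>hessian_base\<close>), again because the term along \<open>\<delta>\<close> carries the factor \<open>\<parallel>\<alpha>\<parallel>\<^sup>2\<close>. The soliton equation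
  identifies this form of rank at most one with a multiple of the diagonal form \<open>\<delta>\<close>. A nonzero null
  vector has at least two nonzero coordinates, so an off-diagonal entry shows that both sides vanish:
  the scalar curvature is the soliton constant \<open>\<rho>\<close> (\<open>scalar_curvature_eq_soliton_constant\<close>). Comparing
  the two values, \<open>\<rho> f\<^sup>2 = \<lambda>\<^sub>F \<noteq> 0\<close>, so \<open>f\<close> is constant.

  The scalar curvature is computed from the Christoffel symbols of the product. On the base these are
  those of a conformally flat metric, given by a vector-valued bilinear form \<open>\<beta>\<close>, so that contractions
  over base indices reduce to inner products of vectors. The fibre symbols stay unevaluated, but have to be
  differentiable for their partial derivatives on the product to be meaningful; this is where
  Cramer's rule enters (\<open>differentiable_inv_metric\<close>).
\<close>

section \<open>Partial derivatives\<close>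

lemma pd_eqI:
  assumes "(f has_derivative f') (at x)"
  shows "pd e f x = f' e"
  using frechet_derivative_at[OF assms] by (simp add: pd_def)

text \<open>The functions need not be differentiable: the same linear maps are their derivatives, so the
  choice operator behind the Frechet derivative picks the same one for both.\<close>

lemma pd_cong_open:
  assumes "open S" "x \<in> S" "\<And>y. y \<in> S \<Longrightarrow> f y = g y"
  shows "pd e f x = pd e g x"
proof -
  have "(f has_derivative f') (at x) \<longleftrightarrow> (g has_derivative f') (at x)" for f'
    using assms has_derivative_transform_within_open[of f f' x UNIV S g]
      has_derivative_transform_within_open[of g f' x UNIV S f]
    by auto
  then show ?thesis
    by (simp add: pd_def frechet_derivative_def)
qed

lemma pd_const [simp]: "pd e (\<lambda>x. c) x = 0"
  by (rule pd_eqI) (rule has_derivative_const)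

text \<open>All coefficients below are sums of such products: a function of the level \<open>x \<bullet> \<alpha>\<close> of the first
  factor times a function on the second factor.\<close>

lemma has_derivative_level_times:
  fixes \<alpha> :: "'e::euclidean_space" and m :: "'f::euclidean_space \<Rightarrow> real"
  assumes c: "(c has_real_derivative c') (at (x \<bullet> \<alpha>))" and m: "m differentiable (at y)"
  shows "((\<lambda>p. c (fst p \<bullet> \<alpha>) * m (snd p)) has_derivative
    (\<lambda>e. c' * (fst e \<bullet> \<alpha>) * m y + c (x \<bullet> \<alpha>) * pd (snd e) m y)) (at (x, y))"
proof -
  have m': "(m has_derivative (\<lambda>v. pd v m y)) (at y)"
    using m unfolding pd_def frechet_derivative_works by simp
  have 1: "((\<lambda>p. c (fst p \<bullet> \<alpha>)) has_derivative (\<lambda>v. c' * (fst v \<bullet> \<alpha>))) (at (x, y))"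
    by (rule has_derivative_compose[where f = "\<lambda>p. fst p \<bullet> \<alpha>" and f' = "\<lambda>v. fst v \<bullet> \<alpha>"
          and g = c and g' = "\<lambda>t. c' * t"])
      (use c in \<open>auto intro!: derivative_eq_intros simp: has_field_derivative_def\<close>)
  have 2: "((\<lambda>p. m (snd p)) has_derivative (\<lambda>v. pd (snd v) m y)) (at (x, y))"
    by (rule has_derivative_compose[where f = snd and f' = snd
          and g = m and g' = "\<lambda>v. pd v m y"])
      (use m' in \<open>auto intro!: derivative_eq_intros\<close>)
  show ?thesis
    by (rule has_derivative_eq_rhs[OF has_derivative_mult[OF 1 2]]) (simp add: add.commute)
qed

lemma has_derivative_level:
  fixes \<alpha> :: "'e::euclidean_space" and y :: "'f::euclidean_space"
  assumes "(c has_real_derivative c') (at (x \<bullet> \<alpha>))"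
  shows "((\<lambda>p. c (fst p \<bullet> \<alpha>)) has_derivative (\<lambda>e. c' * (fst e \<bullet> \<alpha>))) (at (x, y))"
  using has_derivative_level_times[OF assms, where m = "\<lambda>_. 1" and y = y] by simp

lemma pd_zero_direction: "f differentiable (at x) \<Longrightarrow> pd 0 f x = 0"
  unfolding pd_def by (rule linear_0[OF linear_frechet_derivative])

text \<open>The second derivative needs care: smoothness speaks of the Frechet derivative, which is known
  to agree with \<^const>\<open>deriv\<close> only on the set itself, so the set has to be a neighbourhood of the point.\<close>

lemma smooth_on_real_derivatives:
  fixes f :: "real \<Rightarrow> real"
  assumes f: "smooth_on S f" and S: "open S" "t \<in> S"
  shows "(f has_real_derivative deriv f t) (at t)"
    and "(deriv f has_real_derivative deriv (deriv f) t) (at t)"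
proof -
  have C: "C_k_on (Suc (Suc 0)) f S"
    using f by (simp add: smooth_on_def)
  have D: "(f has_real_derivative deriv f s) (at s)" if "s \<in> S" for s
    using C that by (simp add: DERIV_deriv_iff_real_differentiable)
  then show "(f has_real_derivative deriv f t) (at t)"
    using S by blast
  have eq: "frechet_derivative f (at s) 1 = deriv f s" if "s \<in> S" for s
    using frechet_derivative_at[OF D[OF that, unfolded has_field_derivative_def], symmetric] by simp
  have "(\<lambda>s. frechet_derivative f (at s) 1) differentiable (at t)"
    using C S by simp
  then obtain D where "((\<lambda>s. frechet_derivative f (at s) 1) has_derivative D) (at t)"
    unfolding differentiable_def by blast
  then have "(deriv f has_derivative D) (at t)"
    by (rule has_derivative_transform_within_open[OF _ S eq])
  then show "(deriv f has_real_derivative deriv (deriv f) t) (at t)"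
    by (simp add: DERIV_deriv_iff_real_differentiable differentiableI)
qed

section \<open>The inverse metric and the Ricci tensor in coordinates\<close>

lemma sum_Basis_prod:
  fixes F :: "'e::euclidean_space \<times> 'f::euclidean_space \<Rightarrow> 'g::comm_monoid_add"
  shows "sum F Basis = (\<Sum>i\<in>Basis. F (i, 0)) + (\<Sum>i\<in>Basis. F (0, i))"
proof -
  have "inj_on (\<lambda>u. (u::'e, 0::'f)) Basis" "inj_on (\<lambda>u. (0::'e, u::'f)) Basis"
    by (auto intro!: inj_onI)
  then show ?thesis
    unfolding Basis_prod_def by (subst sum.union_disjoint) (auto simp: sum.reindex)
qed

text \<open>The musical isomorphism from vectors to covectors, the latter identified with vectors through
  the coordinates; its matrix is the one that \<^const>\<open>inv_metric\<close> inverts.\<close>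

definition flat :: "'e::euclidean_space form_field \<Rightarrow> 'e \<Rightarrow> 'e \<Rightarrow> 'e" where
  "flat g x v = (\<Sum>c\<in>Basis. g x c v *\<^sub>R c)"

lemma inv_metric_flat: "inv_metric g x a b = inv (flat g x) b \<bullet> a"
  by (simp add: inv_metric_def flat_def[abs_def])

lemma inv_metric_eqI:
  assumes "inj (flat g x)" "flat g x w = b"
  shows "inv_metric g x a b = w \<bullet> a"
  using assms by (simp add: inv_metric_flat inv_f_eq)

lemma flat_inner:
  assumes "c \<in> Basis"
  shows "flat g x v \<bullet> c = g x c v"
  using assms
  by (simp add: flat_def inner_sum_left inner_Basis if_distrib sum.delta cong: if_cong)

lemma linear_flat:
  assumes "bilinear (g x)"
  shows "linear (flat g x)"
  using assms unfolding flat_def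
  by (intro linearI)
    (auto simp: bilinear_radd bilinear_rmul scaleR_add_left sum.distrib scaleR_sum_right)

lemma inj_flat:
  assumes "bilinear (g x)" "\<And>v w. g x v w = g x w v" "\<And>v. (\<And>w. g x v w = 0) \<Longrightarrow> v = 0"
  shows "inj (flat g x)"
proof -
  have "v = 0" if v: "flat g x v = 0" for v
  proof -
    have 0: "g x c v = 0" if "c \<in> Basis" for c
      using flat_inner[OF that, of g x v] v by simp
    have "linear (\<lambda>w. g x w v)"
      using assms(1) by (simp add: bilinear_def)
    then have "g x w v = 0" for w
      using linear_eq_0_on_span[of "\<lambda>w. g x w v" Basis w] 0 by simp
    then show "v = 0"
      using assms(2,3) by metis
  qed
  then show ?thesis
    using linear_injective_0[OF linear_flat, of g x] assms(1) by blast
qed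

lemma differentiable_det:
  fixes A :: "'a::real_normed_vector \<Rightarrow> real ^ 'n ^ 'n"
  assumes "\<And>i j. (\<lambda>y. A y $ i $ j) differentiable (at x within T)"
  shows "(\<lambda>y. det (A y)) differentiable (at x within T)"
proof -
  have "(\<lambda>y. \<Prod>i\<in>S. A y $ i $ p i) differentiable (at x within T)" if "finite S" for S p
    using that by (induction S) (auto intro!: differentiable_mult assms)
  then show ?thesis
    unfolding det_def by (intro derivative_intros) simp_all
qed

text \<open>Grouping the four contributions lets the first contraction of the quadratic part be the trace of
  the Christoffel symbols, which is much simpler than the symbols themselves.\<close>

lemma ricci_eq:
  "ricci g j k x = (\<Sum>i\<in>Basis. pd i (christoffel g i j k) x)
    - (\<Sum>i\<in>Basis. pd j (christoffel g i i k) x)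
    + (\<Sum>m\<in>Basis. (\<Sum>i\<in>Basis. christoffel g i i m x) * christoffel g m j k x)
    - (\<Sum>i\<in>Basis. \<Sum>m\<in>Basis. christoffel g i j m x * christoffel g m i k x)"
proof -
  have "(\<Sum>m\<in>Basis. (\<Sum>i\<in>Basis. christoffel g i i m x) * christoffel g m j k x) =
      (\<Sum>i\<in>Basis. \<Sum>m\<in>Basis. christoffel g i i m x * christoffel g m j k x)"
    unfolding sum_distrib_right by (rule sum.swap)
  then show ?thesis
    by (simp add: ricci_def riemann_def sum.distrib sum_subtractf)
qed

section \<open>Semi-Riemannian metrics on a coordinate domain\<close>

text \<open>What a chart contributes to a semi-Riemannian manifold, and the part of the fibre in the warped product:
  its scalar curvature is never computed, but its Christoffel symbols have to be differentiable, so that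
  their partial derivatives on the product are those on the fibre.\<close>

locale coordinate_metric =
  fixes V :: "(real ^ 'd::finite) set" and q :: "(real ^ 'd) form_field"
  assumes open_V: "open V"
    and smooth_q: "\<And>v w. smooth_on V (\<lambda>y. q y v w)"
    and bilinear_q: "\<And>y. y \<in> V \<Longrightarrow> bilinear (q y)"
    and sym_q: "\<And>y v w. y \<in> V \<Longrightarrow> q y v w = q y w v"
    and nondegenerate_q: "\<And>y v. y \<in> V \<Longrightarrow> (\<And>w. q y v w = 0) \<Longrightarrow> v = 0"
begin

lemma differentiable_q: "y \<in> V \<Longrightarrow> (\<lambda>y. q y v w) differentiable (at y)"
  using smooth_q[of v w] unfolding smooth_on_def by (metis C_k_on.simps(2))

lemma differentiable_pd_q: "y \<in> V \<Longrightarrow> (\<lambda>y. pd e (\<lambda>z. q z v w) y) differentiable (at y)"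
  using smooth_q[of v w] unfolding smooth_on_def pd_def by (metis C_k_on.simps(2))

lemma q_zero:
  assumes y: "y \<in> V"
  shows "q y 0 v = 0" "q y v 0 = 0"
    "pd e (\<lambda>y. q y 0 v) y = 0" "pd e (\<lambda>y. q y v 0) y = 0" "pd 0 (\<lambda>y. q y v w) y = 0"
proof -
  have 0: "q z 0 v = 0" "q z v 0 = 0" if "z \<in> V" for z
    using bilinear_lzero bilinear_rzero bilinear_q[OF that] by blast+
  then show "q y 0 v = 0" "q y v 0 = 0"
    using y by auto
  show "pd e (\<lambda>y. q y 0 v) y = 0" "pd e (\<lambda>y. q y v 0) y = 0"
    using pd_cong_open[OF open_V y 0(1)] pd_cong_open[OF open_V y 0(2)] by simp_all
  show "pd 0 (\<lambda>y. q y v w) y = 0"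
    by (rule pd_zero_direction[OF differentiable_q[OF y]])
qed

lemma flat_q:
  assumes "y \<in> V"
  shows "linear (flat q y)" "inj (flat q y)" "surj (flat q y)"
proof -
  show "linear (flat q y)"
    by (intro linear_flat bilinear_q assms)
  moreover show "inj (flat q y)"
    by (rule inj_flat) (auto intro: bilinear_q sym_q nondegenerate_q assms)
  ultimately show "surj (flat q y)"
    by (rule linear_inj_imp_surj)
qed

lemma inv_metric_pairing:
  assumes "y \<in> V"
  shows "(\<Sum>l\<in>Basis. inv_metric q y a l * q y b l) = b \<bullet> a"
proof -
  note L = flat_q[OF assms]
  have "linear (inv (flat q y))"
    using L by (intro inj_linear_imp_inv_linear)
  then have "inv (flat q y) (flat q y b) = (\<Sum>c\<in>Basis. q y c b *\<^sub>R inv (flat q y) c)"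
    by (simp add: flat_def linear_sum linear_scale)
  then have "b \<bullet> a = (\<Sum>c\<in>Basis. q y c b *\<^sub>R inv (flat q y) c) \<bullet> a"
    using L by simp
  also have "\<dots> = (\<Sum>l\<in>Basis. inv_metric q y a l * q y b l)"
    using assms sym_q by (simp add: inner_sum_left inv_metric_flat mult.commute)
  finally show ?thesis
    by simp
qed

lemma matrix_flat: "matrix (flat q y) = (\<chi> i j. q y (axis i 1) (axis j 1))"
  by (simp add: matrix_def cart_eq_inner_axis flat_inner)

text \<open>By Cramer's rule, the entries of the inverse are rational functions of those of \<open>q\<close>.\<close>

lemma differentiable_inv_metric:
  assumes "y \<in> V"
  shows "(\<lambda>y. inv_metric q y a b) differentiable (at y)"
proof -
  define N where "N z k = (\<chi> i j. if j = k then b $ i else q z (axis i 1) (axis j 1))"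
    for z k
  have formula: "inv_metric q z a b = (\<Sum>k\<in>UNIV. det (N z k) / det (matrix (flat q z)) * a $ k)"
    and det: "det (matrix (flat q z)) \<noteq> 0" if z: "z \<in> V" for z
  proof -
    show d: "det (matrix (flat q z)) \<noteq> 0"
      using flat_q(1,2)[OF z] det_nz_iff_inj by blast
    have "matrix (flat q z) *v inv (flat q z) b = b"
      using flat_q[OF z] by (simp add: matrix_works surj_f_inv_f)
    then have "inv (flat q z) b =
        (\<chi> k. det (\<chi> i j. if j = k then b $ i else matrix (flat q z) $ i $ j) /
          det (matrix (flat q z)))"
      using cramer[OF d] by blast
    then have "inv (flat q z) b = (\<chi> k. det (N z k) / det (matrix (flat q z)))"
      by (simp add: N_def matrix_flat cong: if_cong)
    then show "inv_metric q z a b = (\<Sum>k\<in>UNIV. det (N z k) / det (matrix (flat q z)) * a $ k)"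
      by (simp add: inv_metric_flat inner_vec_def)
  qed
  have entries: "(\<lambda>z. N z k $ i $ j) differentiable (at y)"
    "(\<lambda>z. matrix (flat q z) $ i $ j) differentiable (at y)" for i j k
    using differentiable_q[OF assms] by (cases "j = k"; simp add: N_def matrix_flat)+
  have "(\<lambda>z. \<Sum>k\<in>UNIV. det (N z k) / det (matrix (flat q z)) * a $ k) differentiable (at y)"
    by (intro differentiable_sum differentiable_mult differentiable_divide differentiable_const
        differentiable_det ballI entries det assms) simp
  then obtain D where
    "((\<lambda>z. \<Sum>k\<in>UNIV. det (N z k) / det (matrix (flat q z)) * a $ k) has_derivative D) (at y)"
    unfolding differentiable_def by blast
  then have "((\<lambda>z. inv_metric q z a b) has_derivative D) (at y)"
    by (rule has_derivative_transform_within_open[OF _ open_V assms]) (simp add: formula)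
  then show ?thesis
    unfolding differentiable_def by blast
qed

lemma differentiable_christoffel:
  assumes "y \<in> V"
  shows "christoffel q k i j differentiable (at y)"
  unfolding christoffel_def[abs_def]
  by (intro differentiable_divide differentiable_sum differentiable_mult differentiable_add
      differentiable_diff differentiable_inv_metric differentiable_pd_q differentiable_const
      ballI assms) simp_all

text \<open>The Christoffel symbols of a product split into base and fibre components; a base index is the pair
  of a base vector with \<open>0\<close>, so that the fibre symbols get evaluated at the zero vector.\<close>

lemma christoffel_zero:
  assumes y: "y \<in> V"
  shows "christoffel q k 0 j y = 0" "christoffel q k i 0 y = 0"
    "pd e (christoffel q k 0 j) y = 0" "pd e (christoffel q k i 0) y = 0"
proof -
  have 0: "christoffel q k 0 j z = 0" "christoffel q k i 0 z = 0" if "z \<in> V" for z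
    using that by (simp_all add: christoffel_def q_zero)
  then show "christoffel q k 0 j y = 0" "christoffel q k i 0 y = 0"
    using y by auto
  show "pd e (christoffel q k 0 j) y = 0" "pd e (christoffel q k i 0) y = 0"
    using pd_cong_open[OF open_V y 0(1)] pd_cong_open[OF open_V y 0(2)] by simp_all
qed

end

section \<open>Warped products over a null direction\<close>

text \<open>The metric \<open>\<delta>/\<phi>\<^sup>2 + f\<^sup>2 q\<close> on the points whose level \<open>x \<bullet> \<alpha>\<close> lies in \<open>I\<close>, with \<open>\<alpha>\<close> null for \<open>\<delta>\<close>.
  The tensor \<open>g\<close> is a parameter of its own because it is prescribed only on that domain: in a chart of
  a manifold its values elsewhere are arbitrary.\<close>

locale null_warped_metric = coordinate_metric V q
  for V :: "(real ^ 'd::finite) set" and q :: "(real ^ 'd) form_field" +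
  fixes \<epsilon> :: "'e::euclidean_space \<Rightarrow> real" and \<alpha> :: 'e and I :: "real set"
    and \<phi> f :: "real \<Rightarrow> real" and g :: "('e \<times> (real ^ 'd)) form_field"
  assumes sign: "\<And>i. i \<in> Basis \<Longrightarrow> \<epsilon> i * \<epsilon> i = 1"
    and null: "(\<Sum>i\<in>Basis. \<epsilon> i * (\<alpha> \<bullet> i)\<^sup>2) = 0"
    and open_I: "open I"
    and smooth: "smooth_on I \<phi>" "smooth_on I f"
    and pos: "\<And>t. t \<in> I \<Longrightarrow> \<phi> t > 0" "\<And>t. t \<in> I \<Longrightarrow> f t > 0"
    and metric: "\<And>x y v w. x \<bullet> \<alpha> \<in> I \<Longrightarrow> y \<in> V \<Longrightarrow> g (x, y) v w =
      (\<Sum>i\<in>Basis. \<epsilon> i * (fst v \<bullet> i) * (fst w \<bullet> i)) / (\<phi> (x \<bullet> \<alpha>))\<^sup>2 +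
      (f (x \<bullet> \<alpha>))\<^sup>2 * q y (snd v) (snd w)"
begin

definition domain :: "('e \<times> (real ^ 'd)) set" where
  "domain = {x. x \<bullet> \<alpha> \<in> I} \<times> V"

definition \<delta> :: "'e \<Rightarrow> 'e \<Rightarrow> real" where
  "\<delta> v w = (\<Sum>i\<in>Basis. \<epsilon> i * (v \<bullet> i) * (w \<bullet> i))"

text \<open>The gradient of \<open>x \<bullet> \<alpha>\<close> with respect to \<open>\<delta>\<close>. Since \<open>\<alpha>\<close> is null, it is tangent to the levels of that
  function; the base drops out of the scalar curvature for this reason.\<close>

definition grad :: 'e where
  "grad = (\<Sum>i\<in>Basis. (\<epsilon> i * (\<alpha> \<bullet> i)) *\<^sub>R i)"

text \<open>The coefficients of the connection: \<open>P\<close> governs the conformal change on the base, \<open>Q\<close> the mixed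
  symbols, and \<open>K\<close>, up to sign, the base component of the derivative of a fibre field along a fibre field.\<close>

definition P :: "real \<Rightarrow> real" where "P t = deriv \<phi> t / \<phi> t"
definition Q :: "real \<Rightarrow> real" where "Q t = deriv f t / f t"
definition K :: "real \<Rightarrow> real" where "K t = (\<phi> t)\<^sup>2 * f t * deriv f t"

lemma open_domain: "open domain"
  unfolding domain_def
  by (intro open_Times open_V open_vimage[OF open_I, of "\<lambda>x. x \<bullet> \<alpha>", unfolded vimage_def])
    (intro continuous_intros)

lemma metric_domain:
  "p \<in> domain \<Longrightarrow> g p v w = inverse ((\<phi> (fst p \<bullet> \<alpha>))\<^sup>2) * \<delta> (fst v) (fst w) +
    (f (fst p \<bullet> \<alpha>))\<^sup>2 * q (snd p) (snd v) (snd w)"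
  by (cases p) (auto simp: domain_def metric \<delta>_def field_simps)

lemma DERIV_coefficients:
  assumes t: "t \<in> I"
  shows "(\<phi> has_real_derivative deriv \<phi> t) (at t)"
    and "(f has_real_derivative deriv f t) (at t)"
    and "(P has_real_derivative deriv P t) (at t)"
    and "(Q has_real_derivative deriv Q t) (at t)"
    and "(K has_real_derivative deriv K t) (at t)"
proof -
  note D = smooth_on_real_derivatives[OF smooth(1) open_I t]
    smooth_on_real_derivatives[OF smooth(2) open_I t]
  show "(\<phi> has_real_derivative deriv \<phi> t) (at t)" "(f has_real_derivative deriv f t) (at t)"
    by (rule D)+
  have "\<exists>P'. (P has_real_derivative P') (at t)" "\<exists>Q'. (Q has_real_derivative Q') (at t)"
    "\<exists>K'. (K has_real_derivative K') (at t)"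
    unfolding P_def[abs_def] Q_def[abs_def] K_def[abs_def]
    using pos[OF t] by (auto intro!: exI derivative_eq_intros D)
  then show "(P has_real_derivative deriv P t) (at t)"
    "(Q has_real_derivative deriv Q t) (at t)" "(K has_real_derivative deriv K t) (at t)"
    using DERIV_imp_deriv by auto
qed

lemma \<delta>_Basis:
  assumes "i \<in> Basis"
  shows "\<delta> v i = \<epsilon> i * (v \<bullet> i)" "\<delta> i v = \<epsilon> i * (v \<bullet> i)"
proof -
  have "\<delta> v i = (\<Sum>j\<in>Basis. if j = i then \<epsilon> i * (v \<bullet> i) else 0)"
    using assms unfolding \<delta>_def by (intro sum.cong refl) (auto simp: inner_Basis)
  then show "\<delta> v i = \<epsilon> i * (v \<bullet> i)"
    using assms by simp
  then show "\<delta> i v = \<epsilon> i * (v \<bullet> i)"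
    by (simp add: \<delta>_def mult_ac)
qed

lemma \<delta>_linear:
  "\<delta> w (u + v) = \<delta> w u + \<delta> w v" "\<delta> w (u - v) = \<delta> w u - \<delta> w v" "\<delta> w (c *\<^sub>R u) = c * \<delta> w u"
  by (simp_all add: \<delta>_def inner_add_left inner_diff_left algebra_simps sum.distrib sum_subtractf
      sum_distrib_left)

lemma grad_inner: "i \<in> Basis \<Longrightarrow> grad \<bullet> i = \<epsilon> i * (\<alpha> \<bullet> i)"
  by (simp add: grad_def inner_sum_left inner_Basis if_distrib sum.delta cong: if_cong)

lemma \<delta>_grad: "\<delta> v grad = v \<bullet> \<alpha>" "\<delta> grad v = v \<bullet> \<alpha>"
proof -
  have "\<epsilon> i * (v \<bullet> i) * (grad \<bullet> i) = (v \<bullet> i) * (\<alpha> \<bullet> i)" if "i \<in> Basis" for i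
  proof -
    have "\<epsilon> i * (v \<bullet> i) * (grad \<bullet> i) = (\<epsilon> i * \<epsilon> i) * ((v \<bullet> i) * (\<alpha> \<bullet> i))"
      by (simp add: grad_inner[OF that])
    then show ?thesis
      by (simp add: sign[OF that])
  qed
  then show "\<delta> v grad = v \<bullet> \<alpha>"
    unfolding \<delta>_def euclidean_inner[of v \<alpha>] by (rule sum.cong[OF refl])
  then show "\<delta> grad v = v \<bullet> \<alpha>"
    by (simp add: \<delta>_def mult_ac)
qed

lemma grad_null: "grad \<bullet> \<alpha> = 0" "\<alpha> \<bullet> grad = 0"
proof -
  have "grad \<bullet> \<alpha> = (\<Sum>i\<in>Basis. \<epsilon> i * (\<alpha> \<bullet> i)\<^sup>2)"
    unfolding euclidean_inner[of grad \<alpha>]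
    by (intro sum.cong refl) (simp add: grad_inner power2_eq_square)
  then show "grad \<bullet> \<alpha> = 0" "\<alpha> \<bullet> grad = 0"
    using null by (simp_all add: inner_commute)
qed

subsection \<open>The Levi-Civita connection\<close>

text \<open>The metric \<open>\<delta>/\<phi>\<^sup>2\<close> is a conformal change of a flat one, so its connection differs from the flat
  one by a tensor that is algebraic in the differential of the conformal factor: it is \<open>- P \<beta>\<close>.\<close>

definition \<beta> :: "'e \<Rightarrow> 'e \<Rightarrow> 'e" where
  "\<beta> v w = (v \<bullet> \<alpha>) *\<^sub>R w + (w \<bullet> \<alpha>) *\<^sub>R v - \<delta> v w *\<^sub>R grad"

lemma pd_metric:
  assumes "(x, y) \<in> domain"
  shows "pd e (\<lambda>p. g p v w) (x, y) =
    - 2 * P (x \<bullet> \<alpha>) / (\<phi> (x \<bullet> \<alpha>))\<^sup>2 * (fst e \<bullet> \<alpha>) * \<delta> (fst v) (fst w) +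
    2 * f (x \<bullet> \<alpha>) * deriv f (x \<bullet> \<alpha>) * (fst e \<bullet> \<alpha>) * q y (snd v) (snd w) +
    (f (x \<bullet> \<alpha>))\<^sup>2 * pd (snd e) (\<lambda>y. q y (snd v) (snd w)) y"
proof -
  let ?t = "x \<bullet> \<alpha>"
  have t: "?t \<in> I" and y: "y \<in> V"
    using assms by (auto simp: domain_def)
  have c: "((\<lambda>s. inverse ((\<phi> s)\<^sup>2)) has_real_derivative - 2 * P ?t / (\<phi> ?t)\<^sup>2) (at ?t)"
    using pos(1)[OF t]
    by (auto intro!: derivative_eq_intros DERIV_coefficients[OF t]
        simp: P_def field_simps power2_eq_square)
  have d: "((\<lambda>s. (f s)\<^sup>2) has_real_derivative 2 * f ?t * deriv f ?t) (at ?t)"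
    by (auto intro!: derivative_eq_intros DERIV_coefficients[OF t])
  have "((\<lambda>p. inverse ((\<phi> (fst p \<bullet> \<alpha>))\<^sup>2) * \<delta> (fst v) (fst w) +
      (f (fst p \<bullet> \<alpha>))\<^sup>2 * q (snd p) (snd v) (snd w)) has_derivative
      (\<lambda>e. (- 2 * P ?t / (\<phi> ?t)\<^sup>2 * (fst e \<bullet> \<alpha>)) * \<delta> (fst v) (fst w) +
        (2 * f ?t * deriv f ?t * (fst e \<bullet> \<alpha>) * q y (snd v) (snd w) +
         (f ?t)\<^sup>2 * pd (snd e) (\<lambda>y. q y (snd v) (snd w)) y))) (at (x, y))"
    by (intro has_derivative_add has_derivative_mult_left has_derivative_level[OF c]
        has_derivative_level_times[OF d] differentiable_q y)
  from pd_eqI[where e = e, OF this] show ?thesis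
    using pd_cong_open[OF open_domain assms metric_domain, where e = e] by simp
qed

lemma flat_g:
  assumes xy: "(x, y) \<in> domain"
  shows "flat g (x, y) v = (inverse ((\<phi> (x \<bullet> \<alpha>))\<^sup>2) *\<^sub>R (\<Sum>i\<in>Basis. (\<epsilon> i * (fst v \<bullet> i)) *\<^sub>R i),
    (f (x \<bullet> \<alpha>))\<^sup>2 *\<^sub>R flat q y (snd v))"
proof -
  have "y \<in> V"
    using xy by (simp add: domain_def)
  note B = bilinear_lzero[OF bilinear_q[OF this]]
  have "\<delta> 0 w = 0" for w
    by (simp add: \<delta>_def)
  then show ?thesis
    unfolding flat_def sum_Basis_prod metric_domain[OF xy]
    by (intro prod_eqI)
      (simp_all add: fst_sum snd_sum B \<delta>_Basis scaleR_sum_right)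
qed

lemma inj_flat_g:
  assumes xy: "(x, y) \<in> domain"
  shows "inj (flat g (x, y))"
proof (rule injI)
  fix v w
  assume "flat g (x, y) v = flat g (x, y) w"
  moreover have "x \<bullet> \<alpha> \<in> I" and y: "y \<in> V"
    using xy by (auto simp: domain_def)
  ultimately have 1: "(\<Sum>i\<in>Basis. (\<epsilon> i * (fst v \<bullet> i)) *\<^sub>R i) = (\<Sum>i\<in>Basis. (\<epsilon> i * (fst w \<bullet> i)) *\<^sub>R i)"
    and 2: "flat q y (snd v) = flat q y (snd w)"
    using pos[of "x \<bullet> \<alpha>"] by (auto simp: flat_g[OF xy])
  have "fst v \<bullet> i = fst w \<bullet> i" if i: "i \<in> Basis" for i
  proof -
    have "\<epsilon> i * (fst v \<bullet> i) = \<epsilon> i * (fst w \<bullet> i)"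
      using arg_cong[OF 1, of "\<lambda>u. u \<bullet> i"] i
      by (simp add: inner_sum_left inner_Basis if_distrib sum.delta cong: if_cong)
    then show ?thesis
      using sign[OF i] by auto
  qed
  then show "v = w"
    using injD[OF flat_q(2)[OF y] 2] euclidean_eqI[of "fst v" "fst w"] by (simp add: prod_eqI)
qed

lemma inv_metric_base:
  assumes xy: "(x, y) \<in> domain" and l: "l \<in> Basis"
  shows "inv_metric g (x, y) k (l, 0) = (\<phi> (x \<bullet> \<alpha>))\<^sup>2 * \<epsilon> l * (fst k \<bullet> l)"
proof -
  have t: "x \<bullet> \<alpha> \<in> I" and y: "y \<in> V"
    using xy by (auto simp: domain_def)
  have "(\<Sum>i\<in>Basis. (\<epsilon> i * (((\<phi> (x \<bullet> \<alpha>))\<^sup>2 * \<epsilon> l) *\<^sub>R l \<bullet> i)) *\<^sub>R i) =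
      (\<Sum>i\<in>Basis. if i = l then ((\<phi> (x \<bullet> \<alpha>))\<^sup>2 * (\<epsilon> l * \<epsilon> l)) *\<^sub>R l else 0)"
    using l by (intro sum.cong refl) (simp add: inner_Basis mult_ac)
  also have "\<dots> = (\<phi> (x \<bullet> \<alpha>))\<^sup>2 *\<^sub>R l"
    using l sign[OF l] by simp
  finally have "flat g (x, y) (((\<phi> (x \<bullet> \<alpha>))\<^sup>2 * \<epsilon> l) *\<^sub>R l, 0) = (l, 0)"
    using pos(1)[OF t] linear_0[OF flat_q(1)[OF y]] by (simp add: flat_g[OF xy])
  from inv_metric_eqI[OF inj_flat_g[OF xy] this, of k] show ?thesis
    by (cases k) (simp add: inner_commute)
qed

lemma inv_metric_fiber:
  assumes xy: "(x, y) \<in> domain"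
  shows "inv_metric g (x, y) k (0, l) = inv_metric q y (snd k) l / (f (x \<bullet> \<alpha>))\<^sup>2"
proof -
  have t: "x \<bullet> \<alpha> \<in> I" and y: "y \<in> V"
    using xy by (auto simp: domain_def)
  let ?w = "inv (flat q y) l"
  have "flat g (x, y) (0, inverse ((f (x \<bullet> \<alpha>))\<^sup>2) *\<^sub>R ?w) = (0, l)"
    using pos(2)[OF t] flat_q[OF y] by (simp add: flat_g[OF xy] linear_scale surj_f_inv_f)
  from inv_metric_eqI[OF inj_flat_g[OF xy] this, of k] show ?thesis
    by (cases k) (simp add: inv_metric_flat field_simps)
qed

text \<open>The lower indices are arbitrary vectors, rather than basis vectors, so that the base, fibre and mixed
  cases are all instances of this formula and of \<open>christoffel_fiber\<close>.\<close>

lemma christoffel_base: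
  assumes xy: "(x, y) \<in> domain" and k: "k \<in> Basis"
  shows "christoffel g (k, 0) i j (x, y) =
    - P (x \<bullet> \<alpha>) * (k \<bullet> \<beta> (fst i) (fst j))
    - K (x \<bullet> \<alpha>) * (k \<bullet> grad) * q y (snd i) (snd j)"
proof -
  have t: "x \<bullet> \<alpha> \<in> I" and y: "y \<in> V"
    using xy by (auto simp: domain_def)
  let ?\<phi> = "\<phi> (x \<bullet> \<alpha>)" and ?t = "x \<bullet> \<alpha>"
  define T where "T l = pd i (\<lambda>p. g p j l) (x, y) + pd j (\<lambda>p. g p i l) (x, y) -
    pd l (\<lambda>p. g p i j) (x, y)" for l
  have "inv_metric q y 0 l = 0" for l
    by (simp add: inv_metric_flat)
  then have "christoffel g (k, 0) i j (x, y) =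
      (\<Sum>l\<in>Basis. if l = k then ?\<phi>\<^sup>2 * \<epsilon> k * T (k, 0) else 0) / 2"
    unfolding christoffel_def sum_Basis_prod T_def[symmetric]
    using k
    by (simp add: inv_metric_base[OF xy] inv_metric_fiber[OF xy] inner_Basis if_distrib
        if_distribR eq_commute[of k] cong: if_cong)
  also have "\<dots> = ?\<phi>\<^sup>2 * \<epsilon> k * T (k, 0) / 2"
    using k by simp
  also have "T (k, 0) = - 2 * P ?t / ?\<phi>\<^sup>2 * ((fst i \<bullet> \<alpha>) * (\<epsilon> k * (k \<bullet> fst j)) +
      (fst j \<bullet> \<alpha>) * (\<epsilon> k * (k \<bullet> fst i)) - (k \<bullet> \<alpha>) * \<delta> (fst i) (fst j)) -
      2 * f ?t * deriv f ?t * (k \<bullet> \<alpha>) * q y (snd i) (snd j)"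
    unfolding T_def using k
    by (simp add: pd_metric[OF xy] q_zero[OF y] \<delta>_Basis inner_commute algebra_simps)
  also have "?\<phi>\<^sup>2 * \<epsilon> k * (- 2 * P ?t / ?\<phi>\<^sup>2 * ((fst i \<bullet> \<alpha>) * (\<epsilon> k * (k \<bullet> fst j)) +
      (fst j \<bullet> \<alpha>) * (\<epsilon> k * (k \<bullet> fst i)) - (k \<bullet> \<alpha>) * \<delta> (fst i) (fst j)) -
      2 * f ?t * deriv f ?t * (k \<bullet> \<alpha>) * q y (snd i) (snd j)) / 2 =
    - P ?t * ((fst i \<bullet> \<alpha>) * ((\<epsilon> k * \<epsilon> k) * (k \<bullet> fst j)) +
      (fst j \<bullet> \<alpha>) * ((\<epsilon> k * \<epsilon> k) * (k \<bullet> fst i)) - \<epsilon> k * (k \<bullet> \<alpha>) * \<delta> (fst i) (fst j)) -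
      K ?t * (\<epsilon> k * (k \<bullet> \<alpha>)) * q y (snd i) (snd j)"
    using pos(1)[OF t] by (simp add: K_def field_simps)
  finally show ?thesis
    using grad_inner[OF k]
    by (simp add: sign[OF k] inner_commute[of k grad] inner_add_right inner_diff_right
        inner_commute[of \<alpha> k] \<beta>_def)
qed

lemma christoffel_fiber:
  assumes xy: "(x, y) \<in> domain"
  shows "christoffel g (0, c) i j (x, y) =
    Q (x \<bullet> \<alpha>) * ((fst i \<bullet> \<alpha>) * (snd j \<bullet> c) + (fst j \<bullet> \<alpha>) * (snd i \<bullet> c)) +
    christoffel q c (snd i) (snd j) y"
proof -
  have t: "x \<bullet> \<alpha> \<in> I" and y: "y \<in> V"
    using xy by (auto simp: domain_def)
  let ?f = "f (x \<bullet> \<alpha>)" and ?f' = "deriv f (x \<bullet> \<alpha>)"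
  have "\<delta> v 0 = 0" for v
    by (simp add: \<delta>_def)
  then have "christoffel g (0, c) i j (x, y) = (\<Sum>l\<in>Basis. inv_metric q y c l / ?f\<^sup>2 *
      (2 * ?f * ?f' * (fst i \<bullet> \<alpha>) * q y (snd j) l + 2 * ?f * ?f' * (fst j \<bullet> \<alpha>) * q y (snd i) l +
       ?f\<^sup>2 * (pd (snd i) (\<lambda>y. q y (snd j) l) y + pd (snd j) (\<lambda>y. q y (snd i) l) y -
         pd l (\<lambda>y. q y (snd i) (snd j)) y))) / 2"
    unfolding christoffel_def sum_Basis_prod
    by (simp add: inv_metric_base[OF xy] inv_metric_fiber[OF xy] pd_metric[OF xy] algebra_simps)
  also have "\<dots> = Q (x \<bullet> \<alpha>) * ((fst i \<bullet> \<alpha>) * (\<Sum>l\<in>Basis. inv_metric q y c l * q y (snd j) l) +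
       (fst j \<bullet> \<alpha>) * (\<Sum>l\<in>Basis. inv_metric q y c l * q y (snd i) l)) +
     christoffel q c (snd i) (snd j) y"
    unfolding christoffel_def sum_distrib_left sum_divide_distrib sum.distrib[symmetric]
    using pos(2)[OF t]
    by (intro sum.cong refl) (simp add: Q_def field_simps power2_eq_square)
  finally show ?thesis
    by (simp add: inv_metric_pairing[OF y])
qed

subsection \<open>Contractions\<close>

lemma sum_Basis_inner: "(\<Sum>i\<in>Basis. (i \<bullet> v) * (i \<bullet> w)) = v \<bullet> w" for v w :: "'c::euclidean_space"
  by (simp add: euclidean_inner[of v w] inner_commute)

lemma sum_Basis_\<delta>: "(\<Sum>i\<in>Basis. \<delta> i v * (i \<bullet> w)) = \<delta> v w"
proof -
  have "(\<Sum>i\<in>Basis. \<delta> i v * (i \<bullet> w)) = (\<Sum>i\<in>Basis. \<epsilon> i * (v \<bullet> i) * (w \<bullet> i))"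
    by (intro sum.cong refl) (simp add: \<delta>_Basis inner_commute)
  then show ?thesis
    by (simp add: \<delta>_def)
qed

lemma \<delta>_commute: "\<delta> v w = \<delta> w v"
  by (simp add: \<delta>_def mult_ac)

lemma \<beta>_\<alpha>: "\<beta> v w \<bullet> \<alpha> = 2 * (v \<bullet> \<alpha>) * (w \<bullet> \<alpha>)"
  by (simp add: \<beta>_def inner_diff_left inner_add_left grad_null)

lemma \<beta>_zero: "\<beta> 0 v = 0" "\<beta> v 0 = 0"
  by (simp_all add: \<beta>_def \<delta>_def)

lemma \<beta>_trace: "(\<Sum>i\<in>Basis. i \<bullet> \<beta> i v) = DIM('e) * (v \<bullet> \<alpha>)"
proof -
  have "(\<Sum>i\<in>Basis. i \<bullet> \<beta> i v) =
      (\<Sum>i\<in>Basis. (i \<bullet> \<alpha>) * (i \<bullet> v)) + (\<Sum>i::'e\<in>Basis. v \<bullet> \<alpha>) - (\<Sum>i\<in>Basis. \<delta> i v * (i \<bullet> grad))"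
    unfolding sum.distrib[symmetric] sum_subtractf[symmetric]
    by (intro sum.cong refl) (simp add: \<beta>_def inner_diff_right inner_add_right)
  then show ?thesis
    by (simp add: sum_Basis_inner sum_Basis_\<delta> \<delta>_grad inner_commute)
qed

text \<open>Contracting one index of a bilinear map with a vector evaluates the map at that vector, so a double
  contraction of Christoffel symbols becomes an iterated application of \<open>\<beta>\<close>.\<close>

lemma \<beta>_contract: "(\<Sum>m\<in>Basis. (i \<bullet> \<beta> j m) * (m \<bullet> w)) = i \<bullet> \<beta> j w"
proof -
  have "(\<Sum>m\<in>Basis. (i \<bullet> \<beta> j m) * (m \<bullet> w)) = (j \<bullet> \<alpha>) * (\<Sum>m\<in>Basis. (m \<bullet> i) * (m \<bullet> w)) +
      (i \<bullet> j) * (\<Sum>m\<in>Basis. (m \<bullet> \<alpha>) * (m \<bullet> w)) - (i \<bullet> grad) * (\<Sum>m\<in>Basis. \<delta> m j * (m \<bullet> w))"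
    unfolding sum_distrib_left sum.distrib[symmetric] sum_subtractf[symmetric]
    by (intro sum.cong refl)
      (simp add: \<beta>_def inner_diff_right inner_add_right algebra_simps inner_commute \<delta>_commute[of j])
  then show ?thesis
    by (simp add: sum_Basis_inner sum_Basis_\<delta> \<beta>_def inner_diff_right inner_add_right inner_commute)
qed

lemma \<beta>_square:
  "(\<Sum>i\<in>Basis. \<Sum>m\<in>Basis. (i \<bullet> \<beta> j m) * (m \<bullet> \<beta> i k)) = (DIM('e) + 2) * (j \<bullet> \<alpha>) * (k \<bullet> \<alpha>)"
proof -
  have "(\<Sum>i\<in>Basis. \<Sum>m\<in>Basis. (i \<bullet> \<beta> j m) * (m \<bullet> \<beta> i k)) = (\<Sum>i\<in>Basis. i \<bullet> \<beta> j (\<beta> i k))"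
    by (simp add: \<beta>_contract)
  also have "\<dots> = (j \<bullet> \<alpha>) * (\<Sum>i\<in>Basis. i \<bullet> \<beta> i k)
      + 2 * (k \<bullet> \<alpha>) * (\<Sum>i\<in>Basis. (i \<bullet> \<alpha>) * (i \<bullet> j))
      - \<delta> j k * (\<Sum>i\<in>Basis. (i \<bullet> \<alpha>) * (i \<bullet> grad))
      - (k \<bullet> \<alpha>) * (\<Sum>i\<in>Basis. \<delta> i j * (i \<bullet> grad))
      + (j \<bullet> \<alpha>) * (\<Sum>i\<in>Basis. \<delta> i k * (i \<bullet> grad))"
    unfolding sum_distrib_left sum.distrib[symmetric] sum_subtractf[symmetric]
  proof (intro sum.cong refl)
    fix i
    have \<delta>: "\<delta> j (\<beta> i k) = (i \<bullet> \<alpha>) * \<delta> j k + (k \<bullet> \<alpha>) * \<delta> i j - \<delta> i k * (j \<bullet> \<alpha>)"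
      by (simp add: \<beta>_def \<delta>_linear \<delta>_grad \<delta>_commute[of j i])
    show "i \<bullet> \<beta> j (\<beta> i k) = (j \<bullet> \<alpha>) * (i \<bullet> \<beta> i k) + 2 * (k \<bullet> \<alpha>) * ((i \<bullet> \<alpha>) * (i \<bullet> j))
        - \<delta> j k * ((i \<bullet> \<alpha>) * (i \<bullet> grad)) - (k \<bullet> \<alpha>) * (\<delta> i j * (i \<bullet> grad))
        + (j \<bullet> \<alpha>) * (\<delta> i k * (i \<bullet> grad))"
      unfolding \<beta>_def[of j "\<beta> i k"]
      by (simp add: \<beta>_\<alpha> \<delta> inner_diff_right inner_add_right) (simp add: algebra_simps)
  qed
  also have "\<dots> = (DIM('e) + 2) * (j \<bullet> \<alpha>) * (k \<bullet> \<alpha>)"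
    by (simp add: \<beta>_trace sum_Basis_inner sum_Basis_\<delta> \<delta>_grad grad_null inner_commute algebra_simps)
  finally show ?thesis .
qed

subsection \<open>Ricci and scalar curvature\<close>

lemma pd_christoffel_base:
  assumes xy: "(x, y) \<in> domain" and k: "k \<in> Basis"
  shows "pd e (christoffel g (k, 0) i j) (x, y) =
    - deriv P (x \<bullet> \<alpha>) * (fst e \<bullet> \<alpha>) * (k \<bullet> \<beta> (fst i) (fst j))
    - (k \<bullet> grad) * (deriv K (x \<bullet> \<alpha>) * (fst e \<bullet> \<alpha>) * q y (snd i) (snd j)
        + K (x \<bullet> \<alpha>) * pd (snd e) (\<lambda>y. q y (snd i) (snd j)) y)"
proof -
  have t: "x \<bullet> \<alpha> \<in> I" and y: "y \<in> V"
    using xy by (auto simp: domain_def)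
  have eq: "christoffel g (k, 0) i j p = (- (k \<bullet> \<beta> (fst i) (fst j))) * P (fst p \<bullet> \<alpha>)
      - (k \<bullet> grad) * (K (fst p \<bullet> \<alpha>) * q (snd p) (snd i) (snd j))" if "p \<in> domain" for p
    using christoffel_base[of "fst p" "snd p" k i j] that k by simp
  have "((\<lambda>p. (- (k \<bullet> \<beta> (fst i) (fst j))) * P (fst p \<bullet> \<alpha>)
      - (k \<bullet> grad) * (K (fst p \<bullet> \<alpha>) * q (snd p) (snd i) (snd j))) has_derivative
      (\<lambda>e. (- (k \<bullet> \<beta> (fst i) (fst j))) * (deriv P (x \<bullet> \<alpha>) * (fst e \<bullet> \<alpha>))
        - (k \<bullet> grad) * (deriv K (x \<bullet> \<alpha>) * (fst e \<bullet> \<alpha>) * q y (snd i) (snd j)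
          + K (x \<bullet> \<alpha>) * pd (snd e) (\<lambda>y. q y (snd i) (snd j)) y))) (at (x, y))"
    by (intro has_derivative_diff has_derivative_mult_right has_derivative_level
        has_derivative_level_times DERIV_coefficients t differentiable_q y)
  from pd_eqI[where e = e, OF this] show ?thesis
    using pd_cong_open[OF open_domain xy eq, where e = e] by simp
qed

lemma pd_christoffel_fiber:
  assumes xy: "(x, y) \<in> domain"
  shows "pd e (christoffel g (0, c) i j) (x, y) =
    deriv Q (x \<bullet> \<alpha>) * (fst e \<bullet> \<alpha>) * ((fst i \<bullet> \<alpha>) * (snd j \<bullet> c) + (fst j \<bullet> \<alpha>) * (snd i \<bullet> c)) +
    pd (snd e) (christoffel q c (snd i) (snd j)) y"
proof -
  have t: "x \<bullet> \<alpha> \<in> I" and y: "y \<in> V"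
    using xy by (auto simp: domain_def)
  let ?c = "(fst i \<bullet> \<alpha>) * (snd j \<bullet> c) + (fst j \<bullet> \<alpha>) * (snd i \<bullet> c)"
  \<comment> \<open>The factor \<open>1\<close> brings the fibre part into the shape of \<open>has_derivative_level_times\<close>.\<close>
  have eq: "christoffel g (0, c) i j p =
      ?c * Q (fst p \<bullet> \<alpha>) + 1 * christoffel q c (snd i) (snd j) (snd p)" if "p \<in> domain" for p
    using christoffel_fiber[of "fst p" "snd p" c i j] that by simp
  have "((\<lambda>p. ?c * Q (fst p \<bullet> \<alpha>) + 1 * christoffel q c (snd i) (snd j) (snd p)) has_derivative
      (\<lambda>e. ?c * (deriv Q (x \<bullet> \<alpha>) * (fst e \<bullet> \<alpha>)) +
        (0 * (fst e \<bullet> \<alpha>) * christoffel q c (snd i) (snd j) y +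
         1 * pd (snd e) (christoffel q c (snd i) (snd j)) y))) (at (x, y))"
    by (intro has_derivative_add has_derivative_mult_right has_derivative_level
        has_derivative_level_times[where c = "\<lambda>_. 1"] DERIV_coefficients t DERIV_const
        differentiable_christoffel y)
  from pd_eqI[where e = e, OF this] show ?thesis
    using pd_cong_open[OF open_domain xy eq, where e = e] by simp
qed

text \<open>The coefficient of \<open>\<alpha>\<close> in the trace of the Christoffel symbols.\<close>

definition \<tau> :: "real \<Rightarrow> real" where "\<tau> t = CARD('d) * Q t - DIM('e) * P t"

lemma christoffel_trace:
  assumes xy: "(x, y) \<in> domain"
  shows "(\<Sum>i\<in>Basis. christoffel g i i v (x, y)) =
    \<tau> (x \<bullet> \<alpha>) * (fst v \<bullet> \<alpha>) + (\<Sum>c\<in>Basis. christoffel q c c (snd v) y)"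
proof -
  have y: "y \<in> V"
    using xy by (simp add: domain_def)
  have "(\<Sum>i\<in>Basis. christoffel g (i, 0) (i, 0) v (x, y)) =
      - P (x \<bullet> \<alpha>) * (\<Sum>i\<in>Basis. i \<bullet> \<beta> i (fst v))"
    unfolding sum_distrib_left
    by (intro sum.cong refl) (simp add: christoffel_base[OF xy] q_zero[OF y])
  moreover have "(\<Sum>c\<in>Basis. christoffel g (0, c) (0, c) v (x, y)) =
      CARD('d) * Q (x \<bullet> \<alpha>) * (fst v \<bullet> \<alpha>) + (\<Sum>c\<in>Basis. christoffel q c c (snd v) y)"
    by (simp add: christoffel_fiber[OF xy] sum.distrib)
  ultimately show ?thesis
    by (simp add: sum_Basis_prod \<beta>_trace \<tau>_def algebra_simps)
qed

text \<open>Each of the four contributions to the Ricci tensor is a multiple of \<open>\<alpha> \<otimes> \<alpha>\<close>: a term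
  along \<open>\<delta> j k\<close> arises only with the factor \<open>grad \<bullet> \<alpha> = 0\<close>. The value of the multiple is immaterial, since
  \<open>\<alpha> \<otimes> \<alpha>\<close> has trace zero.\<close>

lemma ricci_base:
  assumes xy: "(x, y) \<in> domain"
  shows "\<exists>C. \<forall>j k. ricci g (j, 0) (k, 0) (x, y) = C * ((j \<bullet> \<alpha>) * (k \<bullet> \<alpha>))"
proof (intro exI allI)
  fix j k
  have y: "y \<in> V"
    using xy by (simp add: domain_def)
  let ?t = "x \<bullet> \<alpha>" and ?jk = "(j \<bullet> \<alpha>) * (k \<bullet> \<alpha>)"
  note [simp] = q_zero[OF y] christoffel_zero[OF y] \<beta>_zero
  have 1: "(\<Sum>i\<in>Basis. pd i (christoffel g i (j, 0) (k, 0)) (x, y)) = - 2 * deriv P ?t * ?jk"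
  proof -
    have "(\<Sum>i\<in>Basis. pd i (christoffel g i (j, 0) (k, 0)) (x, y)) =
        - deriv P ?t * (\<Sum>i\<in>Basis. (i \<bullet> \<alpha>) * (i \<bullet> \<beta> j k))"
      unfolding sum_distrib_left sum_Basis_prod
      by (simp add: pd_christoffel_base[OF xy] pd_christoffel_fiber[OF xy] mult.assoc)
    then show ?thesis
      by (simp add: sum_Basis_inner inner_commute[of \<alpha>] \<beta>_\<alpha>)
  qed
  have 2: "(\<Sum>i\<in>Basis. pd (j, 0) (christoffel g i i (k, 0)) (x, y)) =
      (CARD('d) * deriv Q ?t - DIM('e) * deriv P ?t) * ?jk"
  proof -
    have "(\<Sum>i\<in>Basis. pd (j, 0) (christoffel g (i, 0) (i, 0) (k, 0)) (x, y)) =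
        - deriv P ?t * (j \<bullet> \<alpha>) * (\<Sum>i\<in>Basis. i \<bullet> \<beta> i k)"
      unfolding sum_distrib_left
      by (intro sum.cong refl) (simp add: pd_christoffel_base[OF xy])
    then show ?thesis
      by (simp add: sum_Basis_prod pd_christoffel_fiber[OF xy] \<beta>_trace algebra_simps)
  qed
  have 3: "(\<Sum>m\<in>Basis. (\<Sum>i\<in>Basis. christoffel g i i m (x, y)) * christoffel g m (j, 0) (k, 0) (x, y)) =
      - 2 * P ?t * \<tau> ?t * ?jk"
  proof -
    have "(\<Sum>m\<in>Basis. (\<Sum>i\<in>Basis. christoffel g i i m (x, y)) * christoffel g m (j, 0) (k, 0) (x, y)) =
        - P ?t * \<tau> ?t * (\<Sum>m\<in>Basis. (m \<bullet> \<alpha>) * (m \<bullet> \<beta> j k))"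
      unfolding sum_distrib_left christoffel_trace[OF xy] sum_Basis_prod
      by (simp add: christoffel_base[OF xy] christoffel_fiber[OF xy] mult_ac)
    then show ?thesis
      by (simp add: sum_Basis_inner inner_commute[of \<alpha>] \<beta>_\<alpha>)
  qed
  have 4: "(\<Sum>i\<in>Basis. \<Sum>m\<in>Basis. christoffel g i (j, 0) m (x, y) * christoffel g m i (k, 0) (x, y)) =
      ((P ?t)\<^sup>2 * (DIM('e) + 2) + CARD('d) * (Q ?t)\<^sup>2) * ?jk"
  proof -
    have "(\<Sum>i\<in>Basis. \<Sum>m\<in>Basis. christoffel g (i, 0) (j, 0) (m, 0) (x, y) *
          christoffel g (m, 0) (i, 0) (k, 0) (x, y)) =
        (P ?t)\<^sup>2 * (\<Sum>i\<in>Basis. \<Sum>m\<in>Basis. (i \<bullet> \<beta> j m) * (m \<bullet> \<beta> i k))"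
      unfolding sum_distrib_left
      by (intro sum.cong refl) (simp add: christoffel_base[OF xy] power2_eq_square)
    moreover have "(\<Sum>a\<in>Basis. \<Sum>b\<in>Basis. christoffel g (0, a) (j, 0) (0, b) (x, y) *
          christoffel g (0, b) (0, a) (k, 0) (x, y)) =
        (Q ?t)\<^sup>2 * ?jk * (\<Sum>a::real^'d\<in>Basis. \<Sum>b\<in>Basis. (b \<bullet> a) * (b \<bullet> a))"
      unfolding sum_distrib_left
      by (intro sum.cong refl)
        (simp add: christoffel_fiber[OF xy] power2_eq_square inner_commute mult_ac)
    moreover have "(\<Sum>a::real^'d\<in>Basis. \<Sum>b\<in>Basis. (b \<bullet> a) * (b \<bullet> a)) = CARD('d)"
      by (simp add: sum_Basis_inner)
    ultimately show ?thesis
      by (simp add: sum_Basis_prod sum.distrib christoffel_base[OF xy] christoffel_fiber[OF xy]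
          \<beta>_square algebra_simps)
  qed
  show "ricci g (j, 0) (k, 0) (x, y) =
    (- 2 * deriv P ?t - (CARD('d) * deriv Q ?t - DIM('e) * deriv P ?t) - 2 * P ?t * \<tau> ?t
      - ((P ?t)\<^sup>2 * (DIM('e) + 2) + CARD('d) * (Q ?t)\<^sup>2)) * ?jk"
    unfolding ricci_eq 1 2 3 4 by (simp only: left_diff_distrib)
qed

text \<open>The base contributes through \<open>K\<close> with a vector proportional to \<open>grad\<close>, which is then paired with \<open>\<alpha>\<close>.
  This is the vanishing of the Laplacian and of the squared gradient of \<open>f\<close> in the general formula for
  warped products.\<close>

lemma ricci_fiber:
  assumes xy: "(x, y) \<in> domain"
  shows "ricci g (0, a) (0, b) (x, y) = ricci q a b y"
proof -
  have y: "y \<in> V"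
    using xy by (simp add: domain_def)
  let ?t = "x \<bullet> \<alpha>"
  note [simp] = q_zero[OF y] christoffel_zero[OF y] \<beta>_zero
  have null': "(\<Sum>i\<in>Basis. (i \<bullet> \<alpha>) * (i \<bullet> grad)) = 0"
    by (simp add: sum_Basis_inner grad_null)
  have 1: "(\<Sum>i\<in>Basis. pd i (christoffel g i (0, a) (0, b)) (x, y)) =
      (\<Sum>c\<in>Basis. pd c (christoffel q c a b) y)"
  proof -
    have "(\<Sum>i\<in>Basis. pd (i, 0) (christoffel g (i, 0) (0, a) (0, b)) (x, y)) =
        - deriv K ?t * q y a b * (\<Sum>i\<in>Basis. (i \<bullet> \<alpha>) * (i \<bullet> grad))"
      unfolding sum_distrib_left
      by (intro sum.cong refl) (simp add: pd_christoffel_base[OF xy])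
    then show ?thesis
      by (simp add: sum_Basis_prod pd_christoffel_fiber[OF xy] null')
  qed
  have 2: "(\<Sum>i\<in>Basis. pd (0, a) (christoffel g i i (0, b)) (x, y)) =
      (\<Sum>c\<in>Basis. pd a (christoffel q c c b) y)"
    by (simp add: sum_Basis_prod pd_christoffel_base[OF xy] pd_christoffel_fiber[OF xy])
  have 3: "(\<Sum>m\<in>Basis. (\<Sum>i\<in>Basis. christoffel g i i m (x, y)) * christoffel g m (0, a) (0, b) (x, y)) =
      (\<Sum>m\<in>Basis. (\<Sum>c\<in>Basis. christoffel q c c m y) * christoffel q m a b y)"
  proof -
    have "(\<Sum>m\<in>Basis. (\<tau> ?t * (m \<bullet> \<alpha>)) * christoffel g (m, 0) (0, a) (0, b) (x, y)) =
        - \<tau> ?t * K ?t * q y a b * (\<Sum>m\<in>Basis. (m \<bullet> \<alpha>) * (m \<bullet> grad))"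
      unfolding sum_distrib_left
      by (intro sum.cong refl) (simp add: christoffel_base[OF xy])
    then show ?thesis
      unfolding christoffel_trace[OF xy] sum_Basis_prod
      by (simp add: christoffel_fiber[OF xy] null')
  qed
  have 4: "(\<Sum>i\<in>Basis. \<Sum>m\<in>Basis. christoffel g i (0, a) m (x, y) * christoffel g m i (0, b) (x, y)) =
      (\<Sum>i\<in>Basis. \<Sum>m\<in>Basis. christoffel q i a m y * christoffel q m i b y)"
  proof -
    have "(\<Sum>i\<in>Basis. \<Sum>c\<in>Basis. christoffel g (i, 0) (0, a) (0, c) (x, y) *
          christoffel g (0, c) (i, 0) (0, b) (x, y)) =
        (\<Sum>c\<in>Basis. - K ?t * Q ?t * q y a c * (b \<bullet> c) * (\<Sum>i\<in>Basis. (i \<bullet> \<alpha>) * (i \<bullet> grad)))"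
      unfolding sum_distrib_left
      by (subst sum.swap, intro sum.cong refl)
        (simp add: christoffel_base[OF xy] christoffel_fiber[OF xy])
    moreover have "(\<Sum>c\<in>Basis. \<Sum>m\<in>Basis. christoffel g (0, c) (0, a) (m, 0) (x, y) *
          christoffel g (m, 0) (0, c) (0, b) (x, y)) =
        (\<Sum>c\<in>Basis. - K ?t * Q ?t * q y c b * (a \<bullet> c) * (\<Sum>m\<in>Basis. (m \<bullet> \<alpha>) * (m \<bullet> grad)))"
      unfolding sum_distrib_left
      by (intro sum.cong refl) (simp add: christoffel_base[OF xy] christoffel_fiber[OF xy])
    ultimately have 0: "(\<Sum>i\<in>Basis. \<Sum>c\<in>Basis. christoffel g (i, 0) (0, a) (0, c) (x, y) *
          christoffel g (0, c) (i, 0) (0, b) (x, y)) = 0"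
        "(\<Sum>c\<in>Basis. \<Sum>m\<in>Basis. christoffel g (0, c) (0, a) (m, 0) (x, y) *
          christoffel g (m, 0) (0, c) (0, b) (x, y)) = 0"
      by (simp_all add: null')
    have "christoffel g (i, 0) (0, a) (m, 0) (x, y) = 0" if "i \<in> Basis" for i m
      using that by (simp add: christoffel_base[OF xy])
    moreover have "christoffel g (0, i) (0, a) (0, m) (x, y) = christoffel q i a m y"
      "christoffel g (0, m) (0, i) (0, b) (x, y) = christoffel q m i b y" for i m
      by (simp_all add: christoffel_fiber[OF xy])
    ultimately show ?thesis
      by (simp add: sum_Basis_prod sum.distrib 0)
  qed
  show ?thesis
    unfolding ricci_eq 1 2 3 4 ..
qed

text \<open>The base block of the Ricci tensor is traced with a multiple of the inverse of \<open>\<delta>\<close>, giving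
  \<open>grad \<bullet> \<alpha> = 0\<close>; the fibre block is traced with the inverse of \<open>f\<^sup>2 q\<close>.\<close>

theorem scalar_curvature_null_warped:
  assumes xy: "(x, y) \<in> domain"
  shows "scalar_curvature g (x, y) = scalar_curvature q y / (f (x \<bullet> \<alpha>))\<^sup>2"
proof -
  let ?t = "x \<bullet> \<alpha>"
  obtain C where C: "\<And>j k. ricci g (j, 0) (k, 0) (x, y) = C * ((j \<bullet> \<alpha>) * (k \<bullet> \<alpha>))"
    using ricci_base[OF xy] by blast
  have "(\<Sum>j\<in>Basis. \<Sum>k\<in>Basis. inv_metric g (x, y) (j, 0) (k, 0) * ricci g (j, 0) (k, 0) (x, y)) =
      (\<Sum>k\<in>Basis. (\<phi> ?t)\<^sup>2 * C * (k \<bullet> grad) * (\<Sum>j\<in>Basis. (j \<bullet> k) * (j \<bullet> \<alpha>)))"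
    unfolding sum_distrib_left
    by (subst sum.swap, intro sum.cong refl)
      (simp add: inv_metric_base[OF xy] C inner_commute[of _ grad] grad_inner inner_commute[of \<alpha>])
  also have "\<dots> = (\<phi> ?t)\<^sup>2 * C * (grad \<bullet> \<alpha>)"
    unfolding sum_Basis_inner
    by (subst sum_Basis_inner[of grad \<alpha>, symmetric]) (simp add: sum_distrib_left mult.assoc)
  also have "\<dots> = 0"
    by (simp add: grad_null)
  finally have base: "(\<Sum>j\<in>Basis. \<Sum>k\<in>Basis.
      inv_metric g (x, y) (j, 0) (k, 0) * ricci g (j, 0) (k, 0) (x, y)) = 0" .
  have "inv_metric q y 0 c = 0" for c
    by (simp add: inv_metric_flat)
  then show ?thesis
    unfolding scalar_curvature_def sum_Basis_prod
    using base by (simp add: sum.distrib inv_metric_base[OF xy] inv_metric_fiber[OF xy]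
        ricci_fiber[OF xy] sum_divide_distrib)
qed

subsection \<open>The soliton equation on the base\<close>

text \<open>The correction from the connection is \<open>P h'\<close> times \<open>\<beta> i j \<bullet> \<alpha>\<close>, in which the part of \<open>\<beta>\<close> along \<open>grad\<close>
  drops out, so that the Hessian has rank at most one.\<close>

lemma hessian_base:
  assumes xy: "(x, y) \<in> domain" and h: "smooth_on I h"
    and u: "\<And>p. p \<in> domain \<Longrightarrow> u p = h (fst p \<bullet> \<alpha>)"
  shows "hessian g u (i, 0) (j, 0) (x, y) =
    (deriv (deriv h) (x \<bullet> \<alpha>) + 2 * P (x \<bullet> \<alpha>) * deriv h (x \<bullet> \<alpha>)) * ((i \<bullet> \<alpha>) * (j \<bullet> \<alpha>))"
proof -
  have t: "x \<bullet> \<alpha> \<in> I" and y: "y \<in> V"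
    using xy by (auto simp: domain_def)
  note [simp] = q_zero[OF y] christoffel_zero[OF y]
  have pd_u: "pd e u p = (fst e \<bullet> \<alpha>) * deriv h (fst p \<bullet> \<alpha>)" if p: "p \<in> domain" for e p
  proof -
    have "fst p \<bullet> \<alpha> \<in> I"
      using p by (auto simp: domain_def)
    from has_derivative_level[OF smooth_on_real_derivatives(1)[OF h open_I this], of "snd p"]
    have "pd e (\<lambda>p. h (fst p \<bullet> \<alpha>)) p = (fst e \<bullet> \<alpha>) * deriv h (fst p \<bullet> \<alpha>)"
      by (auto dest!: pd_eqI[where e = e])
    then show ?thesis
      using pd_cong_open[OF open_domain p u, where e = e] by simp
  qed
  have "pd (i, 0) (pd (j, 0) u) (x, y) = deriv (deriv h) (x \<bullet> \<alpha>) * ((i \<bullet> \<alpha>) * (j \<bullet> \<alpha>))"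
  proof -
    have "((\<lambda>p. (j \<bullet> \<alpha>) * deriv h (fst p \<bullet> \<alpha>)) has_derivative
        (\<lambda>e. (j \<bullet> \<alpha>) * (deriv (deriv h) (x \<bullet> \<alpha>) * (fst e \<bullet> \<alpha>)))) (at (x, y))"
      by (intro has_derivative_mult_right has_derivative_level
          smooth_on_real_derivatives(2)[OF h open_I t])
    from pd_eqI[where e = "(i, 0)", OF this] show ?thesis
      using pd_cong_open[OF open_domain xy pd_u[where e = "(j, 0)"], where e = "(i, 0)"]
      by (simp add: mult_ac)
  qed
  moreover have "(\<Sum>k\<in>Basis. christoffel g k (i, 0) (j, 0) (x, y) * pd k u (x, y)) =
      - P (x \<bullet> \<alpha>) * deriv h (x \<bullet> \<alpha>) * (\<Sum>k\<in>Basis. (k \<bullet> \<alpha>) * (k \<bullet> \<beta> i j))"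
    unfolding sum_distrib_left sum_Basis_prod pd_u[OF xy]
    by (simp add: christoffel_base[OF xy] mult_ac)
  ultimately show ?thesis
    unfolding hessian_def by (simp add: sum_Basis_inner inner_commute[of \<alpha>] \<beta>_\<alpha> algebra_simps)
qed

text \<open>The Hessian of the potential is a multiple of \<open>\<alpha> \<otimes> \<alpha>\<close> on the base, whereas the metric is diagonal. A
  nonzero null vector has two nonzero coordinates, and the corresponding off-diagonal equation makes
  the multiple vanish; then a diagonal equation gives the claim.\<close>

lemma scalar_curvature_eq_soliton_constant:
  assumes xy: "(x, y) \<in> domain" and \<alpha>: "\<alpha> \<noteq> 0" and h: "smooth_on I h"
    and u: "\<And>p. p \<in> domain \<Longrightarrow> u p = h (fst p \<bullet> \<alpha>)"
    and soliton: "\<And>i j. i \<in> Basis \<Longrightarrow> j \<in> Basis \<Longrightarrow>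
      (scalar_curvature g (x, y) - \<rho>) * g (x, y) (i, 0) (j, 0) = hessian g u (i, 0) (j, 0) (x, y)"
  shows "scalar_curvature g (x, y) = \<rho>"
proof -
  have t: "x \<bullet> \<alpha> \<in> I" and y: "y \<in> V"
    using xy by (auto simp: domain_def)
  obtain i where i: "i \<in> Basis" "\<alpha> \<bullet> i \<noteq> 0"
    using \<alpha> euclidean_eqI[of \<alpha> 0] by auto
  have "\<exists>j\<in>Basis - {i}. \<alpha> \<bullet> j \<noteq> 0"
  proof (rule ccontr)
    assume "\<not> ?thesis"
    then have "(\<Sum>j\<in>Basis. \<epsilon> j * (\<alpha> \<bullet> j)\<^sup>2) = \<epsilon> i * (\<alpha> \<bullet> i)\<^sup>2"
      using i by (simp add: sum.remove)
    then show False
      using null i sign[of i] by auto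
  qed
  then obtain j where j: "j \<in> Basis" "j \<noteq> i" "\<alpha> \<bullet> j \<noteq> 0"
    by blast
  let ?H = "deriv (deriv h) (x \<bullet> \<alpha>) + 2 * P (x \<bullet> \<alpha>) * deriv h (x \<bullet> \<alpha>)"
  have eq: "(scalar_curvature g (x, y) - \<rho>) * (\<delta> k l / (\<phi> (x \<bullet> \<alpha>))\<^sup>2) = ?H * ((k \<bullet> \<alpha>) * (l \<bullet> \<alpha>))"
    if "k \<in> Basis" "l \<in> Basis" for k l
    using soliton[OF that] hessian_base[where u = u and i = k and j = l, OF xy h u]
    by (simp add: metric_domain[OF xy] q_zero[OF y] divide_inverse mult.commute)
  have "?H = 0"
    using eq[of i j] i j by (simp add: \<delta>_Basis inner_Basis inner_commute[of _ \<alpha>])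
  then show ?thesis
    using eq[of i i] i sign[of i] pos(1)[OF t] by (auto simp: \<delta>_Basis)
qed

end

section \<open>Rigidity of the warping function\<close>

theorem corollary1p7:
  fixes \<epsilon> :: "'n::finite \<Rightarrow> real"
    and \<alpha> :: "real ^ 'n"
    and \<xi> :: "real ^ 'n \<Rightarrow> real"
    and F :: "('p, 'i, real ^ 'd::finite) manifold"
    and g\<^sub>F :: "('i, real ^ 'd) tensor2"
    and lam\<^sub>F \<rho> :: real
    and a b :: ereal
    and \<phi> f h :: "real \<Rightarrow> real"
  assumes n: "CARD('n) \<ge> 3"
    and \<epsilon>: "\<And>i. \<epsilon> i = 1 \<or> \<epsilon> i = -1"
    and F: "semi_riemannian_manifold F g\<^sub>F"
    and F_curv: "constant_scalar_curvature F g\<^sub>F lam\<^sub>F"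
    and \<alpha>: "\<alpha> \<noteq> 0"
    and \<xi>: "\<And>x. \<xi> x = (\<Sum>i\<in>UNIV. \<alpha> $ i * x $ i)"
    and ab: "a < b"
    and \<phi>: "smooth_on (einterval a b) \<phi>" "\<And>t. t \<in> einterval a b \<Longrightarrow> \<phi> t > 0"
    and f: "smooth_on (einterval a b) f" "\<And>t. t \<in> einterval a b \<Longrightarrow> f t > 0"
    and h: "smooth_on (einterval a b) h" "\<And>t. t \<in> einterval a b \<Longrightarrow> h t > 0"
    and soliton:
      "let B = open_manifold (\<xi> -` einterval a b);
           g\<^sub>B = (\<lambda>_ x v w. (\<Sum>i\<in>UNIV. \<epsilon> i * v $ i * w $ i) / (\<phi> (\<xi> x))\<^sup>2)
       in gradient_yamabe_soliton (product_manifold B F)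
            (warped_metric B g\<^sub>B (\<lambda>x. f (\<xi> x)) g\<^sub>F) (\<lambda>(x, p). h (\<xi> x)) \<rho>"
    and null: "(\<Sum>i\<in>UNIV. \<epsilon> i * (\<alpha> $ i)\<^sup>2) = 0"
    and lam: "lam\<^sub>F \<noteq> 0"
  shows "f constant_on einterval a b"
proof -
  let ?I = "einterval a b"
  let ?W = "\<xi> -` ?I"
  let ?B = "open_manifold ?W"
  define g\<^sub>B :: "(unit, real ^ 'n) tensor2"
    where "g\<^sub>B = (\<lambda>_ x v w. (\<Sum>i\<in>UNIV. \<epsilon> i * v $ i * w $ i) / (\<phi> (\<xi> x))\<^sup>2)"
  let ?M = "product_manifold ?B F"
  let ?G = "warped_metric ?B g\<^sub>B (\<lambda>x. f (\<xi> x)) g\<^sub>F"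
  let ?u = "\<lambda>(x, p). h (\<xi> x)"
  have \<xi>_inner: "\<xi> x = x \<bullet> \<alpha>" for x
    by (simp add: \<xi> inner_vec_def mult.commute)
  have W: "?W = {x. x \<bullet> \<alpha> \<in> ?I}"
    by (auto simp: \<xi>_inner)
  have sol: "gradient_yamabe_soliton ?M ?G ?u \<rho>"
    using soliton by (simp add: g\<^sub>B_def Let_def)
  obtain c where c: "c \<in> charts F" "cdom F c \<noteq> {}"
    using F unfolding semi_riemannian_manifold_def smooth_manifold_def by blast
  define V where "V = cimg F c"
  obtain y where y: "y \<in> V"
    using c by (auto simp: V_def cimg_def)
  \<comment> \<open>The signs, indexed by the elements of \<^const>\<open>Basis\<close>: the value at the \<open>i\<close>-th unit vector is \<open>\<epsilon> i\<close>.\<close>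
  define \<epsilon>' where "\<epsilon>' e = (\<Sum>i\<in>UNIV. \<epsilon> i * e $ i)" for e :: "real ^ 'n"
  have \<epsilon>'_axis: "\<epsilon>' (axis i 1) = \<epsilon> i" for i
  proof -
    have "\<epsilon>' (axis i 1) = (\<Sum>j\<in>UNIV. if j = i then \<epsilon> i else 0)"
      unfolding \<epsilon>'_def by (intro sum.cong refl) (auto simp: axis_def)
    then show ?thesis
      by simp
  qed
  have sum_axis: "(\<Sum>e\<in>Basis. \<epsilon>' e * (v \<bullet> e) * (w \<bullet> e)) = (\<Sum>i\<in>UNIV. \<epsilon> i * v $ i * w $ i)"
    for v w :: "real ^ 'n"
  proof -
    have axes: "(Basis :: (real ^ 'n) set) = range (\<lambda>i. axis i 1)"
      by (auto simp: Basis_vec_def)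
    have "inj (\<lambda>i::'n. axis i (1::real))"
      by (simp add: inj_on_def axis_eq_axis)
    then show ?thesis
      unfolding axes by (simp add: sum.reindex inner_axis \<epsilon>'_axis)
  qed
  interpret fiber: coordinate_metric V "g\<^sub>F c"
    using F c(1) unfolding semi_riemannian_manifold_def smooth_manifold_def smooth_tensor2_def V_def
    by unfold_locales blast+
  interpret null_warped_metric V "g\<^sub>F c" \<epsilon>' \<alpha> ?I \<phi> f "?G ((), c)"
  proof unfold_locales
    fix e :: "real ^ 'n"
    assume "e \<in> Basis"
    then obtain i where e: "e = axis i 1"
      by (auto simp: Basis_vec_def)
    then show "\<epsilon>' e * \<epsilon>' e = 1"
      using \<epsilon>[of i] by (auto simp: \<epsilon>'_axis)
  next
    show "(\<Sum>i\<in>Basis. \<epsilon>' i * (\<alpha> \<bullet> i)\<^sup>2) = 0"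
      using sum_axis[of \<alpha> \<alpha>] null by (simp add: power2_eq_square mult.assoc)
  next
    fix x y and v w :: "(real ^ 'n) \<times> (real ^ 'd)"
    assume "x \<bullet> \<alpha> \<in> ?I" "y \<in> V"
    then have "cinv ?B () x = x"
      using inv_into_f_f[of "\<lambda>x. x" ?W x] by (simp add: cinv_def open_manifold_def \<xi>_inner)
    then show "?G ((), c) (x, y) v w = (\<Sum>i\<in>Basis. \<epsilon>' i * (fst v \<bullet> i) * (fst w \<bullet> i)) / (\<phi> (x \<bullet> \<alpha>))\<^sup>2 +
        (f (x \<bullet> \<alpha>))\<^sup>2 * g\<^sub>F c y (snd v) (snd w)"
      by (simp add: warped_metric_def g\<^sub>B_def sum_axis \<xi>_inner split_beta)
  qed (use \<phi> f in auto)
  have chart: "((), c) \<in> charts ?M"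
    using c(1) by (simp add: product_manifold_def open_manifold_def)
  have image: "cimg ?M ((), c) = domain"
  proof -
    have "cimg ?M ((), c) = ?W \<times> V"
      by (simp add: V_def cimg_def product_manifold_def open_manifold_def map_prod_def
          image_paired_Times)
    then show ?thesis
      by (simp add: domain_def W)
  qed
  have u: "(?u \<circ> cinv ?M ((), c)) p = h (fst p \<bullet> \<alpha>)" if p: "p \<in> domain" for p
  proof -
    have "p \<in> cmap ?M ((), c) ` cdom ?M ((), c)"
      using p unfolding image[symmetric] cimg_def .
    then have "cmap ?M ((), c) (cinv ?M ((), c) p) = p"
      unfolding cinv_def by (rule f_inv_into_f)
    then have "fst (cinv ?M ((), c) p) = fst p"
      by (simp add: product_manifold_def open_manifold_def map_prod_def split_beta prod_eq_iff)
    then show ?thesis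
      by (simp add: split_beta \<xi>_inner)
  qed
  have level: "(f t)\<^sup>2 * \<rho> = lam\<^sub>F" if t: "t \<in> ?I" for t
  proof -
    \<comment> \<open>Every level is attained, at a multiple of \<open>\<alpha>\<close>.\<close>
    define x where "x = (t / (\<alpha> \<bullet> \<alpha>)) *\<^sub>R \<alpha>"
    have x: "x \<bullet> \<alpha> = t"
      using \<alpha> by (simp add: x_def)
    then have xy: "(x, y) \<in> domain"
      using t y by (simp add: domain_def)
    have "scalar_curvature (?G ((), c)) (x, y) = \<rho>"
    proof (rule scalar_curvature_eq_soliton_constant[OF xy \<alpha> h(1) u])
      show "(scalar_curvature (?G ((), c)) (x, y) - \<rho>) * ?G ((), c) (x, y) (i, 0) (j, 0) =
          hessian (?G ((), c)) (?u \<circ> cinv ?M ((), c)) (i, 0) (j, 0) (x, y)"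
        if "i \<in> Basis" "j \<in> Basis" for i j
        using sol chart xy that unfolding gradient_yamabe_soliton_def image[symmetric]
        by (auto simp: Basis_prod_def)
    qed
    moreover have "scalar_curvature (g\<^sub>F c) y = lam\<^sub>F"
      using F_curv c(1) y by (simp add: constant_scalar_curvature_def V_def)
    ultimately show ?thesis
      using scalar_curvature_null_warped[OF xy] f(2)[OF t] by (simp add: x field_simps)
  qed
  have "f t = sqrt (lam\<^sub>F / \<rho>)" if t: "t \<in> ?I" for t
  proof -
    have "\<rho> \<noteq> 0"
      using level[OF t] lam by auto
    then have "lam\<^sub>F / \<rho> = (f t)\<^sup>2"
      using level[OF t] by (simp add: field_simps)
    then show ?thesis
      using f(2)[OF t] by simp
  qed
  then show ?thesis
    unfolding constant_on_def by blast
qed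

end
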